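(* Let $n\ge 2$ and let $\mathbf q_1,\dots,\mathbf q_n$ be a Dziobek configuration in $\mathbb S^{n-2}$. Let $d_{ij}$ ($1\le i<j\le n$) be the mutual (geodesic) distances and $F$ the spherical Cayley–Menger determinant. Then, at this configuration, $$\frac{\partial F}{\partial \cos d_{ij}}=2\,\Delta_i\Delta_j\qquad\text{for all } 1\le i<j\le n.$$
   Context: $\mathbb S^{n-2}$ is the unit sphere of $\mathbb R^{n-1}$, and $\cos d_{ij}=\mathbf q_i\cdot\mathbf q_j$. A configuration of $n$ points in $\mathbb S^{n-2}$ is Dziobek if $\operatorname{rank}(\mathbf q_1,\dots,\mathbf q_n)=n-1$. The spherical Cayley–Menger determinant $F$ is the determinant of the symmetric $n\times n$ matrix with diagonal entries $1$ and $(i,j)$ and $(j,i)$ entries both equal to $\cos d_{ij}$ for $i<j$; $F$ is regarded as a polynomial function of the $\binom n2$ independent variables $\cos d_{ij}$, $i<j$, and the partial derivatives are evaluated at the values given by the configuration. $X=[\mathbf q_1,\dots,\mathbf q_n]$ is the $(n-1)\times n$ matrix with columns $\mathbf q_i$, $X_k$ is obtained from $X$ by deleting the $k$-th column, and $\Delta_k=(-1)^{k+1}\det X_k$. *)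

theory Defs
  imports "Jordan_Normal_Form.Determinant" "Jordan_Normal_Form.DL_Rank"
begin

text \<open>
  A configuration of \<open>n\<close> points is a function \<open>q\<close> on the indices \<open>1, \<dots>, n\<close>; its values at other
  indices are irrelevant. Matrices and vectors are indexed from 0, so the columns of the
  matrices below, numbered from 0, correspond to the points in increasing order of index.
\<close>

definition unit_sphere :: "nat \<Rightarrow> real vec set" where
  "unit_sphere m = {v \<in> carrier_vec m. sqrt (v \<bullet> v) = 1}"

definition geodesic_dist :: "real vec \<Rightarrow> real vec \<Rightarrow> real" where
  "geodesic_dist u v = arccos (u \<bullet> v)"

definition config_mat :: "nat \<Rightarrow> (nat \<Rightarrow> real vec) \<Rightarrow> real mat" where
  "config_mat n q = mat_of_cols (n - 1) (map q [1..<n + 1])"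

definition config_mat_del :: "nat \<Rightarrow> (nat \<Rightarrow> real vec) \<Rightarrow> nat \<Rightarrow> real mat" where
  "config_mat_del n q k = mat_of_cols (n - 1) (map q (filter (\<lambda>l. l \<noteq> k) [1..<n + 1]))"

definition Delta :: "nat \<Rightarrow> (nat \<Rightarrow> real vec) \<Rightarrow> nat \<Rightarrow> real" where
  "Delta n q k = (-1) ^ (k + 1) * det (config_mat_del n q k)"

definition dziobek :: "nat \<Rightarrow> (nat \<Rightarrow> real vec) \<Rightarrow> bool" where
  "dziobek n q \<longleftrightarrow>
     (\<forall>i\<in>{1..n}. q i \<in> unit_sphere (n - 1)) \<and>
     vec_space.rank (n - 1) (config_mat n q) = n - 1"

text \<open>
  The independent variables are the values \<open>c (i, j)\<close> with \<open>1 \<le> i < j \<le> n\<close>; no other value of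
  \<open>c\<close> is used. The entry at 0-based position \<open>(a, b)\<close> belongs to the points \<open>a + 1\<close> and \<open>b + 1\<close>.
\<close>

definition cayley_menger_mat :: "nat \<Rightarrow> (nat \<times> nat \<Rightarrow> real) \<Rightarrow> real mat" where
  "cayley_menger_mat n c = mat n n (\<lambda>(a, b).
     if a = b then 1
     else if a < b then c (a + 1, b + 1)
     else c (b + 1, a + 1))"

definition cayley_menger :: "nat \<Rightarrow> (nat \<times> nat \<Rightarrow> real) \<Rightarrow> real" where
  "cayley_menger n c = det (cayley_menger_mat n c)"

definition has_partial_derivative ::
    "(('v \<Rightarrow> real) \<Rightarrow> real) \<Rightarrow> real \<Rightarrow> 'v \<Rightarrow> ('v \<Rightarrow> real) \<Rightarrow> bool" where
  "has_partial_derivative F D v c \<longleftrightarrow>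
     ((\<lambda>t. F (c(v := t))) has_real_derivative D) (at (c v))"

end

theory Submission
  imports Defs
begin

text \<open>
  By Jacobi's formula, the derivative of a determinant is the sum of the derivatives of the entries,
  weighted by their cofactors. The variable \<open>cos d\<^sub>i\<^sub>j\<close> fills two symmetric positions, hence
  the factor 2. At the configuration the matrix is the Gram matrix \<open>X\<^sup>T X\<close>, whose minor obtained by
  deleting row \<open>i\<close> and column \<open>j\<close> is \<open>det (X\<^sub>i\<^sup>T X\<^sub>j) = det X\<^sub>i det X\<^sub>j\<close>, as \<open>X\<^sub>i\<close> and \<open>X\<^sub>j\<close> are square.
\<close>

text \<open>Both sides compute the determinant of \<open>A\<close> with row \<open>i\<close>
  replaced by row \<open>i\<close> of \<open>B\<close>: the left by Laplace expansion along that
  row, the right by the Leibniz formula.\<close>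

lemma det_replace_row:
  fixes A B :: "'a::comm_ring_1 mat"
  assumes A: "A \<in> carrier_mat n n" and i: "i < n"
  shows "(\<Sum>j<n. B $$ (i, j) * cofactor A i j) =
    (\<Sum>p | p permutes {0..<n}. signof p * (B $$ (i, p i) * (\<Prod>k\<in>{0..<n} - {i}. A $$ (k, p k))))"
proof -
  define R where "R = mat n n (\<lambda>(k, j). if k = i then B $$ (i, j) else A $$ (k, j))"
  have R: "R \<in> carrier_mat n n" by (simp add: R_def)
  \<comment> \<open>\<open>R\<close> and \<open>A\<close> differ only in row \<open>i\<close>, which
    the deletion removes.\<close>
  have cofactor_R: "cofactor R i j = cofactor A i j" if "j < n" for j
  proof -
    have "mat_delete R i j = mat_delete A i j"
      using A i that by (intro eq_matI) (auto simp: mat_delete_def R_def)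
    then show ?thesis by (simp add: cofactor_def)
  qed
  have prod_R: "(\<Prod>k = 0..<n. R $$ (k, p k)) =
      B $$ (i, p i) * (\<Prod>k\<in>{0..<n} - {i}. A $$ (k, p k))" if "p permutes {0..<n}" for p
  proof -
    have p: "p k < n" if "k < n" for k
      using permutes_in_image[OF \<open>p permutes {0..<n}\<close>, of k] that by simp
    have "(\<Prod>k = 0..<n. R $$ (k, p k)) =
        R $$ (i, p i) * (\<Prod>k\<in>{0..<n} - {i}. R $$ (k, p k))"
      using i by (intro prod.remove) auto
    also have "(\<Prod>k\<in>{0..<n} - {i}. R $$ (k, p k)) = (\<Prod>k\<in>{0..<n} - {i}. A $$ (k, p k))"
      using p by (intro prod.cong) (auto simp: R_def)
    finally show ?thesis using i p by (simp add: R_def)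
  qed
  have "(\<Sum>j<n. B $$ (i, j) * cofactor A i j) = (\<Sum>j<n. R $$ (i, j) * cofactor R i j)"
    using i by (intro sum.cong) (auto simp: cofactor_R, simp add: R_def)
  also have "\<dots> = det R" using laplace_expansion_row[OF R i] by simp
  finally show ?thesis by (simp add: det_def'[OF R] prod_R)
qed

text \<open>Jacobi's formula, obtained by differentiating the Leibniz formula term by term with the
  product rule.\<close>

lemma has_field_derivative_det:
  fixes A :: "'a::real_normed_field \<Rightarrow> 'a mat"
  assumes A: "\<And>s. A s \<in> carrier_mat n n"
    and deriv: "\<And>i j. i < n \<Longrightarrow> j < n \<Longrightarrow>
      ((\<lambda>s. A s $$ (i, j)) has_field_derivative B $$ (i, j)) (at t)"
  shows "((\<lambda>s. det (A s)) has_field_derivative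
    (\<Sum>i<n. \<Sum>j<n. B $$ (i, j) * cofactor (A t) i j)) (at t)"
proof -
  have "((\<lambda>s. \<Sum>p | p permutes {0..<n}. signof p * (\<Prod>i = 0..<n. A s $$ (i, p i)))
    has_field_derivative (\<Sum>p | p permutes {0..<n}. signof p *
      (\<Sum>i = 0..<n. B $$ (i, p i) * (\<Prod>k\<in>{0..<n} - {i}. A t $$ (k, p k))))) (at t)"
  proof (intro DERIV_sum DERIV_cmult has_field_derivative_prod deriv)
    fix p i assume "p \<in> {p. p permutes {0..<n}}" "i \<in> {0..<n}"
    then show "i < n" "p i < n" using permutes_in_image[of p "{0..<n}" i] by auto
  qed
  also have "(\<Sum>p | p permutes {0..<n}. signof p *
      (\<Sum>i = 0..<n. B $$ (i, p i) * (\<Prod>k\<in>{0..<n} - {i}. A t $$ (k, p k)))) =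
      (\<Sum>i<n. \<Sum>j<n. B $$ (i, j) * cofactor (A t) i j)"
    \<comment> \<open>Exchanging the sums collects, for each row \<open>i\<close>, the terms in
      which the factor from that row is differentiated; \<open>det_replace_row\<close> turns them
      into a cofactor sum.\<close>
    unfolding sum_distrib_left
    by (subst sum.swap, intro sum.cong) (auto simp: det_replace_row[OF A])
  finally show ?thesis by (simp add: det_def'[OF A])
qed

lemma has_partial_derivative_cayley_menger:
  assumes "i < j" "j < n"
  shows "has_partial_derivative (cayley_menger n)
    (cofactor (cayley_menger_mat n c) i j + cofactor (cayley_menger_mat n c) j i)
    (i + 1, j + 1) c"
proof -
  \<comment> \<open>The entrywise derivative: the variable \<open>(i + 1, j + 1)\<close> occupies
    exactly the 0-based positions \<open>(i, j)\<close> and \<open>(j, i)\<close>.\<close>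
  define B :: "real mat" where
    "B = mat n n (\<lambda>(a, b). if a = i \<and> b = j \<or> a = j \<and> b = i then 1 else 0)"
  let ?A = "\<lambda>t. cayley_menger_mat n (c((i + 1, j + 1) := t))"
  have entries: "?A t $$ (a, b) =
      (if a = i \<and> b = j \<or> a = j \<and> b = i then t else cayley_menger_mat n c $$ (a, b))"
    if "a < n" "b < n" for t a b
    using assms that by (auto simp: cayley_menger_mat_def)
  have "((\<lambda>t. det (?A t)) has_field_derivative
      (\<Sum>a<n. \<Sum>b<n. B $$ (a, b) * cofactor (?A (c (i + 1, j + 1))) a b)) (at (c (i + 1, j + 1)))"
    using assms
  proof (intro has_field_derivative_det)
    show "?A t \<in> carrier_mat n n" for t by (simp add: cayley_menger_mat_def)
    show "((\<lambda>t. ?A t $$ (a, b)) has_field_derivative B $$ (a, b)) (at (c (i + 1, j + 1)))"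
      if "a < n" "b < n" for a b
      unfolding entries[OF that] using assms that by (auto simp: B_def)
  qed
  \<comment> \<open>At the base point the update of \<open>c\<close> is trivial, so the cofactors
    are those of the original matrix. As \<open>i < j\<close>, the two positions are distinct and
    the indicator splits into a sum, which collapses to two terms.\<close>
  also have "(\<Sum>a<n. \<Sum>b<n. B $$ (a, b) * cofactor (?A (c (i + 1, j + 1))) a b) =
      (\<Sum>a<n. \<Sum>b<n.
        (if b = j then if a = i then cofactor (cayley_menger_mat n c) i j else 0 else 0) +
        (if b = i then if a = j then cofactor (cayley_menger_mat n c) j i else 0 else 0))"
    using assms by (intro sum.cong) (auto simp: B_def)
  also have "\<dots> = cofactor (cayley_menger_mat n c) i j + cofactor (cayley_menger_mat n c) j i"
    using assms by (simp add: sum.distrib)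
  finally show ?thesis unfolding has_partial_derivative_def cayley_menger_def .
qed

text \<open>\<open>cos\<close> inverts \<open>arccos\<close> on [-1, 1]. The inner product lies
  there because the squared norms of \<open>u - v\<close> and \<open>u + v\<close> are nonnegative
  and, for unit vectors, equal 2 minus and 2 plus twice the inner product.\<close>

lemma cos_geodesic_dist:
  assumes "u \<in> unit_sphere m" "v \<in> unit_sphere m"
  shows "cos (geodesic_dist u v) = u \<bullet> v"
proof -
  have u: "(\<Sum>i<m. u $ i * u $ i) = 1" and v: "(\<Sum>i<m. v $ i * v $ i) = 1"
    using assms by (auto simp: unit_sphere_def scalar_prod_def lessThan_atLeast0)
  have uv: "u \<bullet> v = (\<Sum>i<m. u $ i * v $ i)"
    using assms by (auto simp: unit_sphere_def scalar_prod_def lessThan_atLeast0)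
  have "0 \<le> (\<Sum>i<m. (u $ i - v $ i)\<^sup>2)" "0 \<le> (\<Sum>i<m. (u $ i + v $ i)\<^sup>2)"
    by (simp_all add: sum_nonneg)
  moreover have "(\<Sum>i<m. (u $ i - v $ i)\<^sup>2) = 2 - 2 * (u \<bullet> v)"
    unfolding power2_diff
    by (simp add: power2_eq_square sum.distrib sum_subtractf u v uv
        mult.assoc flip: sum_distrib_left)
  moreover have "(\<Sum>i<m. (u $ i + v $ i)\<^sup>2) = 2 + 2 * (u \<bullet> v)"
    unfolding power2_sum
    by (simp add: power2_eq_square sum.distrib u v uv mult.assoc flip: sum_distrib_left)
  ultimately show ?thesis by (simp add: geodesic_dist_def)
qed

text \<open>Removing point \<open>k + 1\<close> leaves a square matrix. The case split on
  \<open>b < k\<close> is the index shift of \<open>mat_delete\<close> combined with the passage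
  from 0-based columns to 1-based points.\<close>

lemma config_mat_del_cols:
  assumes "k < n"
  shows "config_mat_del n q (k + 1) \<in> carrier_mat (n - 1) (n - 1)"
    and "b < n - 1 \<Longrightarrow> q (if b < k then b + 1 else b + 2) \<in> carrier_vec (n - 1) \<Longrightarrow>
      col (config_mat_del n q (k + 1)) b = q (if b < k then b + 1 else b + 2)"
proof -
  have "[1..<n + 1] = [1..<k + 1] @ [k + 1..<n + 1]"
    using assms upt_add_eq_append[of 1 "k + 1" "n - k"] by simp
  also have "[k + 1..<n + 1] = (k + 1) # [k + 2..<n + 1]"
    using assms by (simp add: upt_conv_Cons)
  finally have filter: "filter (\<lambda>l. l \<noteq> k + 1) [1..<n + 1] = [1..<k + 1] @ [k + 2..<n + 1]"
    by (auto simp: filter_id_conv)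
  have len: "length (filter (\<lambda>l. l \<noteq> k + 1) [1..<n + 1]) = n - 1"
    unfolding filter using assms by auto
  then show "config_mat_del n q (k + 1) \<in> carrier_mat (n - 1) (n - 1)"
    by (metis config_mat_del_def length_map mat_of_cols_carrier(1))
  assume b: "b < n - 1"
    and q: "q (if b < k then b + 1 else b + 2) \<in> carrier_vec (n - 1)"
  have nth: "filter (\<lambda>l. l \<noteq> k + 1) [1..<n + 1] ! b = (if b < k then b + 1 else b + 2)"
    unfolding filter using assms b by (auto simp: nth_append simp del: upt_Suc)
  have "col (config_mat_del n q (k + 1)) b =
      map q (filter (\<lambda>l. l \<noteq> k + 1) [1..<n + 1]) ! b"
    unfolding config_mat_del_def
    by (rule col_mat_of_cols) (use len b q nth in \<open>auto simp del: upt_Suc\<close>)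
  then show "col (config_mat_del n q (k + 1)) b = q (if b < k then b + 1 else b + 2)"
    using nth len b by (simp del: upt_Suc)
qed

lemma cofactor_gram_eq_Delta:
  assumes G: "G \<in> carrier_mat n n"
    and entries: "\<And>a b. a < n \<Longrightarrow> b < n \<Longrightarrow> G $$ (a, b) = q (a + 1) \<bullet> q (b + 1)"
    and q: "\<And>k. k \<in> {1..n} \<Longrightarrow> q k \<in> carrier_vec (n - 1)"
    and i: "i < n" and j: "j < n"
  shows "cofactor G i j = Delta n q (i + 1) * Delta n q (j + 1)"
proof -
  note P = config_mat_del_cols(1)[OF i, of q] config_mat_del_cols(1)[OF j, of q]
  have "mat_delete G i j = (config_mat_del n q (i + 1))\<^sup>T * config_mat_del n q (j + 1)"
  proof (rule eq_matI, goal_cases)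
    case (1 a b)
    then have a: "a < n - 1" and b: "b < n - 1" using P by auto
    have "row (config_mat_del n q (i + 1))\<^sup>T a = q (if a < i then a + 1 else a + 2)"
      using a P(1) by (simp add: config_mat_del_cols(2)[OF i a q] del: One_nat_def)
    moreover have "col (config_mat_del n q (j + 1)) b = q (if b < j then b + 1 else b + 2)"
      using b by (intro config_mat_del_cols(2)[OF j b q]) auto
    ultimately show ?case
      using 1 a b P G by (auto simp: mat_delete_def entries)
  qed (use P G in \<open>auto simp: mat_delete_def\<close>)
  then have "det (mat_delete G i j) =
      det (config_mat_del n q (i + 1)) * det (config_mat_del n q (j + 1))"
    using P by (simp add: det_mult[of _ "n - 1"] det_transpose[of _ "n - 1"])
  \<comment> \<open>The signs agree: those of the two \<open>Delta\<close> factors multiply to (-1)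
    to the power i + j + 4, and the cofactor has exponent i + j.\<close>
  then show ?thesis by (simp add: cofactor_def Delta_def power_add)
qed

theorem proposition5:
  fixes n :: nat and q :: "nat \<Rightarrow> real vec" and d :: "nat \<Rightarrow> nat \<Rightarrow> real"
  assumes "n \<ge> 2"
    and "dziobek n q"
    and "\<And>i j. 1 \<le> i \<Longrightarrow> i < j \<Longrightarrow> j \<le> n \<Longrightarrow> d i j = geodesic_dist (q i) (q j)"
  shows "\<forall>i j. 1 \<le> i \<and> i < j \<and> j \<le> n \<longrightarrow>
    has_partial_derivative (cayley_menger n) (2 * Delta n q i * Delta n q j)
      (i, j) (\<lambda>(k, l). cos (d k l))"
proof (intro allI impI)
  fix i j assume ij: "1 \<le> i \<and> i < j \<and> j \<le> n"
  let ?c = "\<lambda>(k, l). cos (d k l)"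
  let ?G = "cayley_menger_mat n ?c"
  have sphere: "q k \<in> unit_sphere (n - 1)" if "k \<in> {1..n}" for k
    using assms(2) that by (auto simp: dziobek_def)
  then have q: "q k \<in> carrier_vec (n - 1)" if "k \<in> {1..n}" for k
    using that by (auto simp: unit_sphere_def)
  have cos_d: "cos (d k l) = q k \<bullet> q l" if "1 \<le> k" "k < l" "l \<le> n" for k l
    using that assms(3) cos_geodesic_dist[OF sphere sphere] by simp
  \<comment> \<open>The matrix is the Gram matrix of the points: its diagonal because they have norm
    1, its lower triangle by symmetry of the inner product.\<close>
  have entries: "?G $$ (a, b) = q (a + 1) \<bullet> q (b + 1)" if "a < n" "b < n" for a b
  proof (cases a b rule: linorder_cases)
    case less
    then show ?thesis using that cos_d by (simp add: cayley_menger_mat_def)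
  next
    case equal
    then show ?thesis
      using that sphere[of "a + 1"] by (simp add: cayley_menger_mat_def unit_sphere_def)
  next
    case greater
    then show ?thesis
      using that cos_d comm_scalar_prod[OF q q, of "a + 1" "b + 1"]
      by (simp add: cayley_menger_mat_def)
  qed
  have G: "?G \<in> carrier_mat n n" by (simp add: cayley_menger_mat_def)
  have bounds: "i - 1 < n" "j - 1 < n" "i - 1 < j - 1" "i - 1 + 1 = i" "j - 1 + 1 = j"
    using ij by auto
  note cofactor = cofactor_gram_eq_Delta[where q = q, OF G entries q]
  show "has_partial_derivative (cayley_menger n) (2 * Delta n q i * Delta n q j) (i, j) ?c"
    \<comment> \<open>The cofactors at the two symmetric positions both equal the product of the two
      \<open>Delta\<close> values, and their sum gives the factor 2.\<close>
    using has_partial_derivative_cayley_menger[OF bounds(3,2), of ?c]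
      cofactor[OF _ _ _ bounds(1,2)] cofactor[OF _ _ _ bounds(2,1)]
    by (simp only: bounds(4,5)) (simp add: mult_ac)
qed

end
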